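(* Let $K\subset\mathbb{R}^2$ be a compact body and let $\mu$ be a measure on $(K,\mathcal{B}(K))$ with $\mu(K)<\infty$ such that $\mu(\{(\alpha,\beta)\in K:\alpha=x\})=0=\mu(\{(\alpha,\beta)\in K:\beta=y\})$ for all $x,y\in\mathbb{R}$. Then the partial derivatives $D_1F_{K,\mu}$, $D_2F_{K,\mu}$ of the generalized conic function $F_{K,\mu}$ exist everywhere and for all $(x,y)\in\mathbb{R}^2$, $$D_1F_{K,\mu}(x,y)=\mu(\{(\alpha,\beta)\in K:\alpha<x\})-\mu(\{(\alpha,\beta)\in K:x<\alpha\}),$$ $$D_2F_{K,\mu}(x,y)=\mu(\{(\alpha,\beta)\in K:\beta<y\})-\mu(\{(\alpha,\beta)\in K:y<\beta\}).$$
   Context: A compact body in $\mathbb{R}^2$ is a non-empty compact set that coincides with the closure of its interior. $\mathcal{B}(K)$ is the Borel $\sigma$-algebra on $K$. $D_1f$ and $D_2f$ denote the partial derivatives of $f:\mathbb{R}^2\to\mathbb{R}$ with respect to the first and second variable. The generalized conic function associated with $K$ and $\mu$ is $$F_{K,\mu}(x,y):=\int_K\big(|x-\alpha|+|y-\beta|\big)\,\mu(d\alpha,d\beta),\qquad (x,y)\in\mathbb{R}^2.$$ *)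

theory Defs
  imports "HOL-Analysis.Analysis"
begin

definition compact_body :: "(real \<times> real) set \<Rightarrow> bool" where
  "compact_body K \<longleftrightarrow> K \<noteq> {} \<and> compact K \<and> closure (interior K) = K"

definition gen_conic :: "(real \<times> real) set \<Rightarrow> (real \<times> real) measure \<Rightarrow> real \<times> real \<Rightarrow> real" where
  "gen_conic K \<mu> = (\<lambda>(x, y). LINT (\<alpha>, \<beta>):K|\<mu>. \<bar>x - \<alpha>\<bar> + \<bar>y - \<beta>\<bar>)"

text \<open>
  As \<^const>\<open>deriv\<close> is total, existence of the partial derivatives is expressed separately,
  by the predicates \<open>D1_exists\<close> and \<open>D2_exists\<close>.
\<close>

definition D1_exists :: "(real \<times> real \<Rightarrow> real) \<Rightarrow> real \<times> real \<Rightarrow> bool" where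
  "D1_exists f = (\<lambda>(x, y). (\<lambda>t. f (t, y)) field_differentiable at x)"

definition D2_exists :: "(real \<times> real \<Rightarrow> real) \<Rightarrow> real \<times> real \<Rightarrow> bool" where
  "D2_exists f = (\<lambda>(x, y). (\<lambda>t. f (x, t)) field_differentiable at y)"

definition D1 :: "(real \<times> real \<Rightarrow> real) \<Rightarrow> real \<times> real \<Rightarrow> real" where
  "D1 f = (\<lambda>(x, y). deriv (\<lambda>t. f (t, y)) x)"

definition D2 :: "(real \<times> real \<Rightarrow> real) \<Rightarrow> real \<times> real \<Rightarrow> real" where
  "D2 f = (\<lambda>(x, y). deriv (\<lambda>t. f (x, t)) y)"

end

theory Submission
  imports Defs
begin

text \<open>
  The conic function splits as the sum of \<^term>\<open>LINT w|M. \<bar>t - fst w\<bar>\<close> and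
  \<^term>\<open>LINT w|M. \<bar>s - snd w\<bar>\<close>, so each partial derivative is the derivative of an integral
  in one real parameter. For a fixed point with coordinate \<^term>\<open>c\<close>, the function
  \<^term>\<open>\<lambda>t. \<bar>t - c\<bar>\<close> has derivative \<^term>\<open>sgn (x - c)\<close> at every \<^term>\<open>x \<noteq> c\<close>, and as
  \<^term>\<open>\<bar>t - c\<bar>\<close> is 1-Lipschitz in \<^term>\<open>t\<close>, its difference quotients are bounded by the
  constant 1, which is integrable for a finite measure. The exceptional points, those with
  \<^term>\<open>c = x\<close>, form a line, which is null by assumption. Dominated convergence therefore
  allows differentiation (lemma \<open>has_real_derivative_integral_abs_diff\<close>)
  under the integral sign, and the integral of \<^term>\<open>sgn (x - c)\<close> is the mass on one side of the
  line minus the mass on the other.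
\<close>

lemma has_real_derivative_abs_diff:
  fixes x c :: real
  assumes "x \<noteq> c"
  shows "((\<lambda>t. \<bar>t - c\<bar>) has_real_derivative sgn (x - c)) (at x)"
proof -
  have "((\<lambda>t. sgn (x - c) * (t - c)) has_real_derivative sgn (x - c)) (at x)"
    by (auto intro!: derivative_eq_intros)
  moreover have "open {t. 0 < sgn (x - c) * (t - c)}"
    by (intro open_Collect_less continuous_intros)
  ultimately show ?thesis
    by (rule has_field_derivative_transform_within_open)
       (use assms in \<open>auto simp: sgn_if split: if_splits\<close>)
qed

text \<open>
  Differentiation under the integral sign with the constant dominating function 1. The hypothesis
  that the level set of \<^term>\<open>x\<close> is null is what makes the difference quotients converge
  almost everywhere.
\<close>

lemma (in finite_measure) has_real_derivative_integral_abs_diff: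
  fixes g :: "'a \<Rightarrow> real"
  assumes g: "integrable M g" and null: "AE w in M. g w \<noteq> x"
  shows "((\<lambda>t. LINT w|M. \<bar>t - g w\<bar>) has_real_derivative
           measure M {w \<in> space M. g w < x} - measure M {w \<in> space M. x < g w}) (at x)"
proof -
  have [measurable]: "g \<in> borel_measurable M"
    using g by auto
  have int: "integrable M (\<lambda>w. \<bar>t - g w\<bar>)" for t
    using g by auto
  have "(LINT w|M. sgn (x - g w)) =
      (LINT w|M. indicator {w \<in> space M. g w < x} w - indicator {w \<in> space M. x < g w} w)"
    by (intro Bochner_Integration.integral_cong) (auto simp: sgn_if indicator_def)
  also have "\<dots> = measure M {w \<in> space M. g w < x} - measure M {w \<in> space M. x < g w}"
    by (subst Bochner_Integration.integral_diff)
       (auto simp: emeasure_finite less_top[symmetric] intro!: integrable_real_indicator)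
  finally have limit: "(LINT w|M. sgn (x - g w)) =
      measure M {w \<in> space M. g w < x} - measure M {w \<in> space M. x < g w}" .
  have "((\<lambda>t. ((LINT w|M. \<bar>t - g w\<bar>) - (LINT w|M. \<bar>x - g w\<bar>)) / (t - x))
      \<longlongrightarrow> (LINT w|M. sgn (x - g w))) (at x)"
    unfolding tendsto_at_iff_sequentially comp_def
  proof (intro allI impI)
    fix X :: "nat \<Rightarrow> real"
    assume ne: "\<forall>i. X i \<in> UNIV - {x}" and lim: "X \<longlonglongrightarrow> x"
    let ?q = "\<lambda>i w. (\<bar>X i - g w\<bar> - \<bar>x - g w\<bar>) / (X i - x)"
    have "(\<lambda>i. LINT w|M. ?q i w) \<longlonglongrightarrow> (LINT w|M. sgn (x - g w))"
    proof (rule integral_dominated_convergence)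
      show "integrable M (\<lambda>w. 1 :: real)"
        by simp
      show "AE w in M. (\<lambda>i. ?q i w) \<longlonglongrightarrow> sgn (x - g w)"
        using null
      proof eventually_elim
        case (elim w)
        then have "((\<lambda>t. (\<bar>t - g w\<bar> - \<bar>x - g w\<bar>) / (t - x)) \<longlongrightarrow> sgn (x - g w)) (at x)"
          using has_real_derivative_abs_diff[of x "g w"] by (simp add: has_field_derivative_iff)
        then show ?case
          using ne lim unfolding tendsto_at_iff_sequentially comp_def by blast
      qed
      show "AE w in M. norm (?q i w) \<le> 1" for i
        using ne by (intro AE_I2) (auto simp: divide_le_eq)
    qed measurable
    then show "(\<lambda>i. ((LINT w|M. \<bar>X i - g w\<bar>) - (LINT w|M. \<bar>x - g w\<bar>)) / (X i - x))
        \<longlonglongrightarrow> (LINT w|M. sgn (x - g w))"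
      by (simp add: int)
  qed
  then show ?thesis
    by (simp add: has_field_derivative_iff limit)
qed

theorem lemma2p2:
  fixes K :: "(real \<times> real) set" and \<mu> :: "(real \<times> real) measure"
  assumes "compact_body K"
    and "space \<mu> = K"
    and "sets \<mu> = sets (restrict_space borel K)"
    and "emeasure \<mu> K < \<infinity>"
    and "\<And>x. emeasure \<mu> {(\<alpha>, \<beta>) \<in> K. \<alpha> = x} = 0"
    and "\<And>y. emeasure \<mu> {(\<alpha>, \<beta>) \<in> K. \<beta> = y} = 0"
  shows "\<forall>x y. D1_exists (gen_conic K \<mu>) (x, y) \<and> D2_exists (gen_conic K \<mu>) (x, y) \<and>
    D1 (gen_conic K \<mu>) (x, y) =
      measure \<mu> {(\<alpha>, \<beta>) \<in> K. \<alpha> < x} - measure \<mu> {(\<alpha>, \<beta>) \<in> K. x < \<alpha>} \<and>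
    D2 (gen_conic K \<mu>) (x, y) =
      measure \<mu> {(\<alpha>, \<beta>) \<in> K. \<beta> < y} - measure \<mu> {(\<alpha>, \<beta>) \<in> K. y < \<beta>}"
proof -
  interpret finite_measure \<mu>
    using assms(2,4) by (intro finite_measureI) auto
  have mfst[measurable]: "fst \<in> borel_measurable \<mu>" and msnd[measurable]: "snd \<in> borel_measurable \<mu>"
    by (simp_all add: measurable_cong_sets[OF assms(3) refl] measurable_restrict_space1
        borel_measurable_continuous_onI continuous_intros)
  \<comment> \<open>Compactness bounds both coordinates, hence makes them integrable for the finite measure,
    so that the conic integral splits into a sum of two finite integrals.\<close>
  have "bounded K"
    using assms(1) by (auto simp: compact_body_def compact_imp_bounded)
  then obtain B where B: "\<And>w. w \<in> K \<Longrightarrow> norm w \<le> B"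
    by (auto simp: bounded_iff)
  have "\<bar>fst w\<bar> \<le> B" "\<bar>snd w\<bar> \<le> B" if "w \<in> K" for w
    using B[OF that] norm_fst_le[of "fst w" "snd w"] norm_snd_le[of "snd w" "fst w"] by simp_all
  then have ifst: "integrable \<mu> fst" and isnd: "integrable \<mu> snd"
    using assms(2) by (auto intro!: integrable_const_bound[where B = B] AE_I2)
  have split: "gen_conic K \<mu> (t, s) = (LINT w|\<mu>. \<bar>t - fst w\<bar>) + (LINT w|\<mu>. \<bar>s - snd w\<bar>)" for t s
  proof -
    have "gen_conic K \<mu> (t, s) = (LINT w|\<mu>. \<bar>t - fst w\<bar> + \<bar>s - snd w\<bar>)"
      unfolding gen_conic_def set_lebesgue_integral_def case_prod_beta
      by (auto simp: assms(2) intro!: Bochner_Integration.integral_cong)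
    then show ?thesis
      using ifst isnd by simp
  qed
  have nfst: "AE w in \<mu>. fst w \<noteq> x" for x
  proof (rule AE_I)
    have "{w \<in> space \<mu>. \<not> fst w \<noteq> x} = {(\<alpha>, \<beta>) \<in> K. \<alpha> = x}"
      by (auto simp: assms(2))
    then show "emeasure \<mu> {w \<in> space \<mu>. \<not> fst w \<noteq> x} = 0"
      by (simp only: assms(5))
    show "{w \<in> space \<mu>. \<not> fst w \<noteq> x} \<in> sets \<mu>"
      by measurable
  qed simp
  have nsnd: "AE w in \<mu>. snd w \<noteq> x" for x
  proof (rule AE_I)
    have "{w \<in> space \<mu>. \<not> snd w \<noteq> x} = {(\<alpha>, \<beta>) \<in> K. \<beta> = x}"
      by (auto simp: assms(2))
    then show "emeasure \<mu> {w \<in> space \<mu>. \<not> snd w \<noteq> x} = 0"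
      by (simp only: assms(6))
    show "{w \<in> space \<mu>. \<not> snd w \<noteq> x} \<in> sets \<mu>"
      by measurable
  qed simp
  have coord: "{w \<in> space \<mu>. P (fst w) (snd w)} = {(\<alpha>, \<beta>) \<in> K. P \<alpha> \<beta>}" for P
    by (auto simp: assms(2))
  have d1: "((\<lambda>t. gen_conic K \<mu> (t, y)) has_real_derivative
      measure \<mu> {(\<alpha>, \<beta>) \<in> K. \<alpha> < x} - measure \<mu> {(\<alpha>, \<beta>) \<in> K. x < \<alpha>}) (at x)" for x y
    using DERIV_add[OF has_real_derivative_integral_abs_diff[OF ifst nfst] DERIV_const]
    unfolding split coord[of "\<lambda>\<alpha> \<beta>. \<alpha> < _"] coord[of "\<lambda>\<alpha> \<beta>. _ < \<alpha>"] add_0_right by blast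
  have d2: "((\<lambda>t. gen_conic K \<mu> (x, t)) has_real_derivative
      measure \<mu> {(\<alpha>, \<beta>) \<in> K. \<beta> < y} - measure \<mu> {(\<alpha>, \<beta>) \<in> K. y < \<beta>}) (at y)" for x y
    using DERIV_add[OF DERIV_const has_real_derivative_integral_abs_diff[OF isnd nsnd]]
    unfolding split coord[of "\<lambda>\<alpha> \<beta>. \<beta> < _"] coord[of "\<lambda>\<alpha> \<beta>. _ < \<beta>"] add_0_left by blast
  have "(\<lambda>t. gen_conic K \<mu> (t, y)) field_differentiable at x"
    "(\<lambda>t. gen_conic K \<mu> (x, t)) field_differentiable at y" for x y
    using d1 d2 unfolding field_differentiable_def by blast+
  then show ?thesis
    by (simp add: D1_exists_def D2_exists_def D1_def D2_def DERIV_imp_deriv[OF d1] DERIV_imp_deriv[OF d2])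
qed

end
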